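(* Let $(\Omega,X_n,\mathbb{P}_x)$ be a discrete time Markov chain (without killing) on a finite set $V$. Let $V_1,V_2,\dots,V_m$ be a sequence of subsets of $V$ such that $$\emptyset\neq V_1\subset V_2\subset\cdots\subset V_m=V.$$ Then for any $A\subset V$ and $x\in V$ such that $\mathbb{P}_x(\tau_A<\infty)=1$, we have $$\mathbb{P}_x\big(\mathfrak{L}(X|_{[0,\tau_A]})\in\bullet\big)=\mathbb{P}_x\big(\mathfrak{L}_{V_m}\circ\cdots\circ\mathfrak{L}_{V_2}\circ\mathfrak{L}_{V_1}(X|_{[0,\tau_A]})\in\bullet\big),$$ i.e. the random finite paths $\mathfrak{L}(X|_{[0,\tau_A]})$ and $\mathfrak{L}_{V_m}\circ\cdots\circ\mathfrak{L}_{V_1}(X|_{[0,\tau_A]})$ have the same law under $\mathbb{P}_x$.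
   Context: Markov chain. $V$ is a finite set with a Markov kernel $P:V\times V\to[0,1]$, $\sum_{y}P(x,y)=1$ for all $x$; $(\Omega,X_n,\mathbb{P}_x)$ is the associated time-homogeneous Markov chain, with $\mathbb{P}_x(X_0=x)=1$. For $A\subset V$, $\tau_A=\min\{n\ge 0:X_n\in A\}$ (with $\min\emptyset=\infty$). On $\{\tau_A<\infty\}$, $X|_{[0,\tau_A]}=(X_0,X_1,\dots,X_{\tau_A})$. Finite paths. A finite path on $V$ is a sequence $\mathbf{w}=(w_0,\dots,w_\eta)$ of points of $V$. Partial loop erasure (PLE). Let $\widetilde V\subset V$ and let $\mathbf{w}=(w_0,\dots,w_\eta)$ be a finite path on $V$. Put $n_0=0$ and, iteratively for $i\ge1$, $$n_i=\begin{cases}\max\{n_{i-1}\le n\le\eta:w_n=w_{n_{i-1}}\}+1,&\text{if }w_{n_{i-1}}\in\widetilde V\text{ and }w_{n_{i-1}}\ne w_\eta,\\ n_{i-1}+1,&\text{if }w_{n_{i-1}}\notin\widetilde V\text{ and }n_{i-1}\neq\eta.\end{cases}$$ The procedure stops when neither case applies; let $n_\iota$ be the last index found (so $w_{n_\iota}=w_\eta$). Then $\mathfrak{L}_{\widetilde V}(\mathbf{w})=(w_{n_0},w_{n_1},\dots,w_{n_\iota})$. Loop erasure (LE). $\mathfrak{L}=\mathfrak{L}_V$, i.e. the usual chronological loop erasure: $n_0=0$, $n_i=\max\{n_{i-1}\le n\le \eta:w_n=w_{n_{i-1}}\}+1$ as long as $w_{n_{i-1}}\neq w_\eta$. *)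

theory Defs
  imports "HOL-Probability.Probability"
begin

definition markov_kernel :: "'a set \<Rightarrow> ('a \<Rightarrow> 'a \<Rightarrow> real) \<Rightarrow> bool" where
  "markov_kernel V P \<longleftrightarrow>
     (\<forall>x\<in>V. \<forall>y\<in>V. 0 \<le> P x y \<and> P x y \<le> 1) \<and> (\<forall>x\<in>V. (\<Sum>y\<in>V. P x y) = 1)"

text \<open>
  A time-homogeneous Markov chain on a finite set \<open>V\<close> with kernel \<open>P\<close>: one measurable space \<open>\<Omega>\<close>
  (only its space and sigma-algebra are used), one process \<open>X\<close> on it, and for every starting
  point \<open>x \<in> V\<close> a probability measure \<open>PP x\<close> on \<open>\<Omega>\<close>.
\<close>

locale markov_chain =
  fixes V :: "'a set"
    and P :: "'a \<Rightarrow> 'a \<Rightarrow> real"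
    and \<Omega> :: "'w measure"
    and X :: "nat \<Rightarrow> 'w \<Rightarrow> 'a"
    and PP :: "'a \<Rightarrow> 'w measure"
  assumes finite_states: "finite V"
    and kernel: "markov_kernel V P"
    and process_measurable: "\<And>n. X n \<in> measurable \<Omega> (count_space V)"
    and prob_spaces: "\<And>x. x \<in> V \<Longrightarrow> prob_space (PP x)"
    and sets_PP: "\<And>x. x \<in> V \<Longrightarrow> sets (PP x) = sets \<Omega>"
    and start: "\<And>x. x \<in> V \<Longrightarrow> \<P>(\<omega> in PP x. X 0 \<omega> = x) = 1"
    and markov_property:
      "\<And>x n w y. x \<in> V \<Longrightarrow> y \<in> V \<Longrightarrow> \<P>(\<omega> in PP x. \<forall>i\<le>n. X i \<omega> = w i) > 0 \<Longrightarrow>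
         \<P>(\<omega> in PP x. X (Suc n) \<omega> = y \<bar> \<forall>i\<le>n. X i \<omega> = w i) = P (w n) y"

definition hitting_time :: "(nat \<Rightarrow> 'w \<Rightarrow> 'a) \<Rightarrow> 'a set \<Rightarrow> 'w \<Rightarrow> enat" where
  "hitting_time X A \<omega> = Inf (enat ` {n. X n \<omega> \<in> A})"

text \<open>
  A finite path \<open>(w\<^sub>0, \<dots>, w\<^sub>\<eta>)\<close> is a nonempty list, so \<open>\<eta> = length w - 1\<close>. The path below is
  meaningful only where the hitting time is finite.
\<close>

definition path_until_hit :: "(nat \<Rightarrow> 'w \<Rightarrow> 'a) \<Rightarrow> 'a set \<Rightarrow> 'w \<Rightarrow> 'a list" where
  "path_until_hit X A \<omega> = map (\<lambda>n. X n \<omega>) [0..<Suc (the_enat (hitting_time X A \<omega>))]"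

definition ple_next :: "'a set \<Rightarrow> 'a list \<Rightarrow> nat \<Rightarrow> nat option" where
  "ple_next U w k =
     (let \<eta> = length w - 1 in
      if w ! k \<in> U \<and> w ! k \<noteq> w ! \<eta> then Some (Max {n. k \<le> n \<and> n \<le> \<eta> \<and> w ! n = w ! k} + 1)
      else if w ! k \<notin> U \<and> k \<noteq> \<eta> then Some (k + 1)
      else None)"

text \<open>The index \<open>n\<^sub>i\<close>; the value \<open>None\<close> means that the procedure has stopped before step \<open>i\<close>.\<close>

primrec ple_index :: "'a set \<Rightarrow> 'a list \<Rightarrow> nat \<Rightarrow> nat option" where
  "ple_index U w 0 = Some 0"
| "ple_index U w (Suc i) = Option.bind (ple_index U w i) (ple_next U w)"

definition partial_loop_erasure :: "'a set \<Rightarrow> 'a list \<Rightarrow> 'a list" where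
  "partial_loop_erasure U w =
     (let \<iota> = Max {i. ple_index U w i \<noteq> None}
      in map (\<lambda>i. w ! the (ple_index U w i)) [0..<Suc \<iota>])"

definition loop_erasure :: "'a set \<Rightarrow> 'a list \<Rightarrow> 'a list" where
  "loop_erasure V = partial_loop_erasure V"

text \<open>The composition of the partial loop erasures for \<open>W 1, \<dots>, W m\<close>, with \<open>W 1\<close> applied first.\<close>

primrec iterated_ple :: "(nat \<Rightarrow> 'a set) \<Rightarrow> nat \<Rightarrow> 'a list \<Rightarrow> 'a list" where
  "iterated_ple W 0 = id"
| "iterated_ple W (Suc k) = partial_loop_erasure (W (Suc k)) \<circ> iterated_ple W k"

end

theory Submission
  imports Defs
begin

text \<open>
  Give a path the product of the transition probabilities of the chain killed on \<open>A\<close>. For a set \<open>U\<close>,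
  let \<open>\<mu>\<^sub>U\<close> be the image of this measure on paths under the partial loop erasure for \<open>U\<close>. It charges
  only paths \<open>\<gamma>\<close> that visit each point of \<open>U\<close> at most once, and there \<open>\<mu>\<^sub>U(\<gamma>) = weight \<gamma> * F(U \<inter> \<gamma>)\<close>,
  where \<open>F {u\<^sub>1, \<dots>, u\<^sub>n}\<close> is the product of the Green's functions at \<open>u\<^sub>i\<close> of the chain killed on
  \<open>u\<^sub>1, \<dots>, u\<^sub>i\<^sub>-\<^sub>1\<close>; the order of the points does not matter. Erasing the loops at one more point \<open>v\<close>
  maps \<open>\<mu>\<^sub>U\<close> to the measure given by the formula for \<open>insert v U\<close>: the loops to be summed are
  distributed like the partially erased loops at \<open>v\<close>, whose total weight is a Green's function because
  erasure preserves mass. For a fixed target path, erasing a set \<open>W\<close> amounts to erasing its points one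
  by one in the order of the target. So \<open>\<mu>\<^sub>U\<close> is mapped to \<open>\<mu>\<^sub>U\<^sub>'\<close> whenever \<open>U \<subseteq> U'\<close>, and both
  laws in the theorem come from \<open>\<mu>\<^sub>V\<close>. All sums are taken in \<open>ennreal\<close>, so no summability is needed.
\<close>

section \<open>Erasing loops of lists\<close>

text \<open>The default matters: a list without \<open>v\<close> is returned unchanged. Applied to
  the tail behind an occurrence of \<open>v\<close>, the function therefore leaves that tail alone
  when there is no return to \<open>v\<close>.\<close>

fun after_last :: "'a \<Rightarrow> 'a list \<Rightarrow> 'a list" where
  "after_last v [] = []"
| "after_last v (a # l) = (if v \<in> set l then after_last v l else if a = v then l else a # l)"

lemma after_last_notin [simp]: "v \<notin> set l \<Longrightarrow> after_last v l = l"
  by (cases l) auto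

lemma after_last_append: "v \<notin> set r \<Longrightarrow> after_last v (l @ v # r) = r"
  by (induction l) auto

lemma notin_after_last: "v \<notin> set (after_last v l)"
  by (induction l) auto

lemma length_after_last: "length (after_last v l) \<le> length l"
  by (induction l) auto

text \<open>The part cut off, with the leading \<open>v\<close> put back, is a loop at
  \<open>v\<close>; it is the trivial loop \<open>[v]\<close> when \<open>w\<close> does not return
  to \<open>v\<close>.\<close>

lemma after_last_split: "\<exists>l. v # w = l @ after_last v w \<and> l \<noteq> [] \<and> hd l = v \<and> last l = v"
proof (cases "v \<in> set w")
  case True
  then obtain ys zs where w: "w = ys @ v # zs" "v \<notin> set zs"
    by (meson split_list_last)
  then show ?thesis
    by (intro exI[of _ "v # ys @ [v]"]) (simp add: after_last_append)
qed (auto intro!: exI[of _ "[v]"])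

text \<open>Recursive form of the partial loop erasure; \<open>partial_loop_erasure_eq_erase\<close>
  links it to the index procedure.\<close>

function erase :: "'a set \<Rightarrow> 'a list \<Rightarrow> 'a list" where
  "erase U [] = []"
| "erase U (a # l) = a # erase U (if a \<in> U then after_last a l else l)"
  by pat_completeness auto
termination
  by (relation "Wellfounded.measure (\<lambda>(U, l). length l)") (auto simp: less_Suc_eq_le length_after_last)

lemma erase_disjoint: "set l \<inter> U = {} \<Longrightarrow> erase U l = l"
  by (induction l) auto

lemma set_after_last: "set (after_last v l) \<subseteq> set l"
  by (induction l) auto

lemma set_erase: "set (erase U l) \<subseteq> set l"
  by (induction U l rule: erase.induct) (use set_after_last in \<open>fastforce split: if_splits\<close>)+

lemma erase_append_disjoint: "set l \<inter> U = {} \<Longrightarrow> erase U (l @ r) = l @ erase U r"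
  by (induction l) auto

lemma erase_notin: "v \<notin> set l \<Longrightarrow> erase (U - {v}) l = erase U l"
proof (induction U l rule: erase.induct)
  case (2 U a l)
  then have "v \<notin> set (if a \<in> U then after_last a l else l)"
    using set_after_last[of a l] by (auto split: if_splits)
  with 2 show ?case by auto
qed simp

lemma erase_eq_Nil [simp]: "erase U l = [] \<longleftrightarrow> l = []"
  by (cases l) auto

lemma hd_erase: "hd (erase U l) = hd l"
  by (cases l) auto

lemma last_after_last: "after_last v l \<noteq> [] \<Longrightarrow> last (after_last v l) = last l"
  by (induction l) (auto split: if_splits)

lemma after_last_Nil: "after_last v l = [] \<Longrightarrow> l \<noteq> [] \<Longrightarrow> last l = v"
  by (induction l) (auto split: if_splits)

lemma last_erase: "last (erase U l) = last l"
proof (induction U l rule: erase.induct)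
  case (2 U a l)
  then show ?case
    using last_after_last[of a l] after_last_Nil[of a l] by auto
qed simp

text \<open>Nothing is erased before the first point of \<open>W\<close>, since no point of
  \<open>U\<close> occurs earlier, and that point itself is kept.\<close>

lemma find_erase: "U \<subseteq> W \<Longrightarrow> find (\<lambda>a. a \<in> W) (erase U l) = find (\<lambda>a. a \<in> W) l"
  by (induction U l rule: erase.induct) auto

text \<open>Both sides copy the list up to the first visit to \<open>v\<close> and resume after its
  last visit. From there on \<open>v\<close> is absent, so removing it from \<open>W\<close> changes
  nothing.\<close>

lemma erase_peel: "find (\<lambda>a. a \<in> W) l = Some v \<Longrightarrow> erase W l = erase (W - {v}) (erase {v} l)"
proof (induction l)
  case (Cons a l)
  show ?case
  proof (cases "a \<in> W")
    case True
    then have "a = v" using Cons.prems by simp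
    with True show ?thesis
      by (simp add: erase_disjoint notin_after_last erase_notin)
  next
    case False
    then have "a \<noteq> v"
      using Cons.prems by (auto simp: find_Some_iff nth_Cons split: nat.splits)
    with False Cons show ?thesis by simp
  qed
qed simp

text \<open>Erasing one point at a time agrees with erasing \<open>W\<close> at once only if the points are taken in the order
  in which the target \<open>r\<close> visits them; hence the equivalence is stated for a fixed \<open>r\<close>.\<close>

lemma erase_eq_iff_peel:
  assumes "find (\<lambda>a. a \<in> W) r = Some v"
  shows "erase W l = r \<longleftrightarrow> erase (W - {v}) (erase {v} l) = r"
proof -
  have v: "v \<in> W"
    using assms by (auto simp: find_Some_iff)
  have "find (\<lambda>a. a \<in> W) l = Some v" if "erase W l = r"
    using that assms find_erase[of W W l] by auto
  moreover have "find (\<lambda>a. a \<in> W) l = Some v" if "erase (W - {v}) (erase {v} l) = r"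
    using that assms find_erase[of "W - {v}" W "erase {v} l"] find_erase[of "{v}" W l] v by auto
  ultimately show ?thesis
    using erase_peel by metis
qed

definition simple_in :: "'a set \<Rightarrow> 'a list \<Rightarrow> bool" where
  "simple_in U l \<longleftrightarrow> distinct (filter (\<lambda>a. a \<in> U) l)"

lemma simple_in_after_last: "simple_in U l \<Longrightarrow> simple_in U (after_last v l)"
  by (induction l) (auto simp: simple_in_def split: if_splits)

text \<open>There is no loop to erase at a point of \<open>U\<close>, and \<open>after_last\<close>
  preserves this property of the tail.\<close>

lemma erase_simple_in: "simple_in U l \<Longrightarrow> erase W l = erase (W - U) l"
proof (induction W l rule: erase.induct)
  case (2 W a l)
  have s: "simple_in U l" "a \<in> U \<Longrightarrow> a \<notin> set l"
    using 2(2) by (auto simp: simple_in_def split: if_splits)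
  then show ?case
    using 2(1) simple_in_after_last[OF s(1), of a] by auto
qed simp

text \<open>A preimage is cut at its first and last visits to \<open>v\<close>: \<open>p\<close> is
  what precedes them, \<open>r\<close> what follows, and anything in between is an arbitrary loop at
  \<open>v\<close>.\<close>

lemma erase_singleton_fiber:
  assumes "v \<notin> set p" "v \<notin> set r"
  shows "bij_betw (\<lambda>l. p @ l @ r) {l. l \<noteq> [] \<and> hd l = v \<and> last l = v} {w. erase {v} w = p @ v # r}"
proof (rule bij_betwI')
  fix l assume "l \<in> {l. l \<noteq> [] \<and> hd l = v \<and> last l = v}"
  then obtain l' where l: "l = v # l'" "l' = [] \<or> last l' = v"
    by (cases l) (auto split: if_splits)
  have "after_last v (l' @ r) = r"
  proof (cases "l' = []")
    case False
    then have "l' @ r = butlast l' @ v # r"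
      using l by (metis append_Cons append_Nil append_assoc append_butlast_last_id)
    then show ?thesis using after_last_append[OF assms(2)] by metis
  qed (use assms in simp)
  then show "p @ l @ r \<in> {w. erase {v} w = p @ v # r}"
    using l assms by (simp add: erase_append_disjoint erase_disjoint)
next
  fix w assume w: "w \<in> {w. erase {v} w = p @ v # r}"
  have "v \<in> set w"
    using w set_erase[of "{v}" w] by auto
  then obtain p' q where q: "w = p' @ v # q" "v \<notin> set p'"
    by (meson split_list_first)
  then have "p' @ v # after_last v q = p @ v # r"
    using w by (simp add: erase_append_disjoint erase_disjoint notin_after_last)
  then have "p' = p" "after_last v q = r"
    using append_Cons_eq_iff[of v p' "after_last v q" p r] q assms notin_after_last[of v q] by auto
  then show "\<exists>l\<in>{l. l \<noteq> [] \<and> hd l = v \<and> last l = v}. w = p @ l @ r"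
    using after_last_split[of v q] q by auto
qed auto

text \<open>If \<open>w\<close> met \<open>W\<close>, its first point of \<open>W\<close> would
  survive the erasure and lie on \<open>r\<close>.\<close>

lemma erase_notin_fiber:
  assumes "set r \<inter> W = {}"
  shows "erase W w = r \<longleftrightarrow> w = r"
proof
  assume *: "erase W w = r"
  have "find (\<lambda>a. a \<in> W) r = None"
    using assms by (auto simp: find_None_iff)
  then have "find (\<lambda>a. a \<in> W) w = None"
    using find_erase[of W W w] * by simp
  then have "set w \<inter> W = {}"
    by (auto simp: find_None_iff)
  with * show "w = r" by (simp add: erase_disjoint)
qed (use assms in \<open>simp add: erase_disjoint\<close>)

lemma count_erase_singleton: "count_list (erase {v} w) v \<le> 1"
proof (induction "{v}" w rule: erase.induct)
  case (2 a l)
  then show ?case by (auto simp: erase_disjoint notin_after_last)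
qed simp

section \<open>Agreement of the index procedure with the recursive erasure\<close>

primrec ple_from :: "'a set \<Rightarrow> 'a list \<Rightarrow> nat \<Rightarrow> nat \<Rightarrow> nat option" where
  "ple_from U w n 0 = Some n"
| "ple_from U w n (Suc i) = Option.bind (ple_from U w n i) (ple_next U w)"

lemma ple_index_eq: "ple_index U w i = ple_from U w 0 i"
  by (induction i) auto

text \<open>The defining equation splits off the last step, this one the first. It is the reason for
  making the starting index a parameter, and it matches the recursion of
  \<open>erase\<close>.\<close>

lemma ple_from_Suc:
  "ple_from U w n (Suc i) = Option.bind (ple_next U w n) (\<lambda>n'. ple_from U w n' i)"
  by (induction i) (auto split: bind_splits)

lemma ple_next_erase:
  assumes "n < length w"
  shows "(ple_next U w n = None \<and> erase U (drop n w) = [w ! n]) \<or>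
    (\<exists>n'. ple_next U w n = Some n' \<and> n < n' \<and> n' < length w \<and>
       erase U (drop n w) = w ! n # erase U (drop n' w))"
proof -
  define e where "e = length w - 1"
  have w: "drop n w = w ! n # drop (Suc n) w"
    using assms by (rule Cons_nth_drop_Suc[symmetric])
  show ?thesis
  proof (cases "w ! n \<in> U")
    case False
    then show ?thesis
      using assms w by (auto simp: ple_next_def Let_def)
  next
    case True
    define S where "S = {i. n \<le> i \<and> i \<le> e \<and> w ! i = w ! n}"
    \<comment> \<open>\<open>j\<close> is the time of the last visit to \<open>w ! n\<close>, so the
      next index is \<open>Suc j\<close>.\<close>
    define j where "j = Max S"
    have "finite S" "n \<in> S"
      using assms by (auto simp: S_def e_def intro: finite_subset[of _ "{..e}"])
    then have j: "j \<in> S" "\<And>i. i \<in> S \<Longrightarrow> i \<le> j"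
      unfolding j_def by (auto intro: Max_in)
    then have jn: "n \<le> j" "j \<le> e" "w ! j = w ! n" "j < length w"
      using assms by (auto simp: S_def e_def)
    have notin: "w ! n \<notin> set (drop (Suc j) w)"
    proof
      assume "w ! n \<in> set (drop (Suc j) w)"
      then obtain i where i: "i < length w - Suc j" "w ! (Suc j + i) = w ! n"
        by (auto simp: in_set_conv_nth)
      then have "Suc j + i \<in> S"
        using jn by (auto simp: S_def e_def)
      then show False using j(2) by fastforce
    qed
    have al: "after_last (w ! n) (drop (Suc n) w) = drop (Suc j) w"
    proof (cases "j = n")
      case False
      then have "drop (Suc n) w = take (j - Suc n) (drop (Suc n) w) @ drop j w"
        using jn by (metis Suc_leI append_take_drop_id drop_drop le_add_diff_inverse2 le_neq_implies_less)
      also have "drop j w = w ! n # drop (Suc j) w"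
        using jn by (metis Cons_nth_drop_Suc)
      finally show ?thesis
        using notin by (metis after_last_append)
    qed (use notin in simp)
    have erase: "erase U (drop n w) = w ! n # erase U (drop (Suc j) w)"
      using True al w by simp
    show ?thesis
    proof (cases "w ! n = w ! e")
      \<comment> \<open>The last visit is then the end of the path: the procedure stops, and
        \<open>erase\<close> is left with an empty tail.\<close>
      case eq: True
      then have "e \<in> S" using assms by (auto simp: S_def e_def)
      then have "j = e" using j(2) jn by force
      then show ?thesis
        using True eq erase assms by (simp add: ple_next_def Let_def e_def)
    next
      case False
      then have "j < e" using jn by (cases "j = e") auto
      moreover have "ple_next U w n = Some (Suc j)"
        using True False by (simp add: ple_next_def Let_def j_def S_def e_def)
      ultimately show ?thesis
        using erase jn by (auto simp: e_def)
    qed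
  qed
qed

text \<open>The witness \<open>t\<close> is the number of steps made before stopping. The defined
  indices are exactly those up to \<open>t\<close>, which identifies the maximum in
  \<open>partial_loop_erasure\<close>.\<close>

lemma ple_from_erase:
  "n < length w \<Longrightarrow> \<exists>t. (\<forall>i. ple_from U w n i \<noteq> None \<longleftrightarrow> i \<le> t) \<and>
     map (\<lambda>i. w ! the (ple_from U w n i)) [0..<Suc t] = erase U (drop n w)"
proof (induction "length w - n" arbitrary: n rule: less_induct)
  case less
  consider "ple_next U w n = None" "erase U (drop n w) = [w ! n]"
    | n' where "ple_next U w n = Some n'" "n < n'" "n' < length w"
        "erase U (drop n w) = w ! n # erase U (drop n' w)"
    using ple_next_erase[OF less.prems, of U] by metis
  then show ?case
  proof cases
    case 1
    have "ple_from U w n i \<noteq> None \<longleftrightarrow> i \<le> 0" for i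
      using 1 by (cases i) (auto simp: ple_from_Suc simp del: ple_from.simps(2))
    then show ?thesis using 1 by (intro exI[of _ 0]) auto
  next
    case 2
    have "length w - n' < length w - n"
      using 2 by linarith
    then obtain t where t: "\<And>i. ple_from U w n' i \<noteq> None \<longleftrightarrow> i \<le> t"
      "map (\<lambda>i. w ! the (ple_from U w n' i)) [0..<Suc t] = erase U (drop n' w)"
      using less.hyps[of n'] 2(3) by blast
    have s: "ple_from U w n (Suc i) = ple_from U w n' i" for i
      using 2 by (simp add: ple_from_Suc del: ple_from.simps(2))
    have "ple_from U w n i \<noteq> None \<longleftrightarrow> i \<le> Suc t" for i
      using t(1) by (cases i) (auto simp: s simp del: ple_from.simps(2))
    moreover have "map (\<lambda>i. w ! the (ple_from U w n i)) [0..<Suc (Suc t)] =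
        w ! n # map (\<lambda>i. w ! the (ple_from U w n (Suc i))) [0..<Suc t]"
      by (subst upt_conv_Cons) (simp_all add: map_Suc_upt[symmetric] del: upt_Suc ple_from.simps(2))
    ultimately show ?thesis
      using t(2) 2(4) by (intro exI[of _ "Suc t"]) (simp only: s simp_thms)
  qed
qed

lemma partial_loop_erasure_eq_erase:
  assumes "w \<noteq> []"
  shows "partial_loop_erasure U w = erase U w"
proof -
  obtain t where t: "\<And>i. ple_from U w 0 i \<noteq> None \<longleftrightarrow> i \<le> t"
    "map (\<lambda>i. w ! the (ple_from U w 0 i)) [0..<Suc t] = erase U w"
    using ple_from_erase[of 0 w U] assms by auto
  have "Max {i. ple_index U w i \<noteq> None} = t"
    using t(1) by (auto simp: ple_index_eq intro!: Max_eqI intro: finite_subset[of _ "{..t}"])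
  then show ?thesis
    using t(2) by (simp add: partial_loop_erasure_def ple_index_eq Let_def del: upt_Suc)
qed

section \<open>Sums over paths\<close>

lemma append_Cons_eq_prefix:
  "p @ v # r = p' @ v # r' \<Longrightarrow> v \<notin> set p \<Longrightarrow> v \<notin> set p' \<Longrightarrow> p = p'"
proof (induction p arbitrary: p')
  case (Cons a p)
  then show ?case by (cases p') auto
qed (auto simp: Cons_eq_append_conv)

lemma nn_integral_count_space_image:
  "inj_on g S \<Longrightarrow> (\<integral>\<^sup>+y. f y \<partial>count_space (g ` S)) = (\<integral>\<^sup>+x. f (g x) \<partial>count_space S)"
  by (rule nn_integral_bij_count_space[symmetric]) (simp add: bij_betw_imageI)

lemma nn_integral_count_space_swap:
  fixes f :: "'a \<Rightarrow> 'b \<Rightarrow> ennreal"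
  shows "(\<integral>\<^sup>+a. (\<integral>\<^sup>+b. f a b \<partial>count_space UNIV) \<partial>count_space UNIV) =
    (\<integral>\<^sup>+b. (\<integral>\<^sup>+a. f a b \<partial>count_space UNIV) \<partial>count_space UNIV)"
  using nn_integral_fst_count_space[of "case_prod f"] nn_integral_snd_count_space[of "case_prod f"]
  by simp

text \<open>Tonelli's theorem for counting measures: with the constraint written as an indicator,
  only \<open>b = h a\<close> contributes for given \<open>a\<close>. This computes image measures
  under erasure.\<close>

lemma nn_integral_count_space_fibers:
  fixes f :: "'a \<Rightarrow> ennreal" and h :: "'a \<Rightarrow> 'b"
  shows "(\<integral>\<^sup>+b. (\<integral>\<^sup>+a. f a \<partial>count_space {a \<in> S. h a = b}) \<partial>count_space T) =
    (\<integral>\<^sup>+a. f a \<partial>count_space {a \<in> S. h a \<in> T})"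
proof -
  have "(\<integral>\<^sup>+b. (\<integral>\<^sup>+a. f a \<partial>count_space {a \<in> S. h a = b}) \<partial>count_space T) =
      (\<integral>\<^sup>+b. (\<integral>\<^sup>+a. f a * indicator S a * indicator {h a} b * indicator T b \<partial>count_space UNIV) \<partial>count_space UNIV)"
    by (subst (1 2) nn_integral_count_space_indicator, simp, simp)
      (auto intro!: nn_integral_cong simp: nn_integral_multc[symmetric] split: split_indicator)
  also have "\<dots> = (\<integral>\<^sup>+a. (\<integral>\<^sup>+b. f a * indicator S a * indicator T (h a) * indicator {h a} b \<partial>count_space UNIV) \<partial>count_space UNIV)"
    by (subst nn_integral_count_space_swap)
      (auto intro!: nn_integral_cong split: split_indicator)
  also have "\<dots> = (\<integral>\<^sup>+a. f a \<partial>count_space {a \<in> S. h a \<in> T})"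
    by (subst (3) nn_integral_count_space_indicator, simp)
      (auto intro!: nn_integral_cong simp: nn_integral_cmult split: split_indicator)
  finally show ?thesis .
qed

lemma nn_integral_count_space_times:
  fixes f :: "'a \<Rightarrow> ennreal" and g :: "'b \<Rightarrow> ennreal"
  shows "(\<integral>\<^sup>+(a, b). f a * g b \<partial>count_space (S \<times> T)) =
    (\<integral>\<^sup>+a. f a \<partial>count_space S) * (\<integral>\<^sup>+b. g b \<partial>count_space T)"
proof -
  have "(\<integral>\<^sup>+(a, b). f a * g b \<partial>count_space (S \<times> T)) =
      (\<integral>\<^sup>+(a, b). (f a * indicator S a) * (g b * indicator T b) \<partial>count_space UNIV)"
    by (subst nn_integral_count_space_indicator, simp)
      (auto intro!: nn_integral_cong split: split_indicator)
  also have "\<dots> = (\<integral>\<^sup>+a. \<integral>\<^sup>+b. (f a * indicator S a) * (g b * indicator T b) \<partial>count_space UNIV \<partial>count_space UNIV)"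
    by (subst nn_integral_fst_count_space[symmetric]) simp
  also have "\<dots> = (\<integral>\<^sup>+a. f a * indicator S a \<partial>count_space UNIV) * (\<integral>\<^sup>+b. g b * indicator T b \<partial>count_space UNIV)"
    by (simp add: nn_integral_cmult nn_integral_multc)
  also have "\<dots> = (\<integral>\<^sup>+a. f a \<partial>count_space S) * (\<integral>\<^sup>+b. g b \<partial>count_space T)"
    by (subst (3 4) nn_integral_count_space_indicator) simp_all
  finally show ?thesis .
qed

lemma nn_integral_count_space_Un_disjoint:
  fixes f :: "'a \<Rightarrow> ennreal"
  assumes "A \<inter> B = {}"
  shows "(\<integral>\<^sup>+a. f a \<partial>count_space (A \<union> B)) =
    (\<integral>\<^sup>+a. f a \<partial>count_space A) + (\<integral>\<^sup>+a. f a \<partial>count_space B)"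
  apply (subst (1 2 3) nn_integral_count_space_indicator, simp, simp, simp)
  apply (subst nn_integral_add[symmetric])
  using assms by (auto intro!: nn_integral_cong split: split_indicator)

lemma nn_integral_count_space_singleton: "(\<integral>\<^sup>+a. f a \<partial>count_space {x}) = (f x :: ennreal)"
  by (simp add: nn_integral_count_space_finite)

section \<open>Path weights, loops and Green's functions\<close>

context
  fixes k :: "'a \<Rightarrow> 'a \<Rightarrow> ennreal"
begin

fun weight :: "'a list \<Rightarrow> ennreal" where
  "weight (a # b # l) = k a b * weight (b # l)"
| "weight l = 1"

text \<open>The cut point \<open>v\<close> belongs to both pieces, because weights are attached to
  transitions and a single point has weight 1.\<close>

lemma weight_append: "weight (p @ v # r) = weight (p @ [v]) * weight (v # r)"
  by (induction p rule: weight.induct) (auto simp: mult_ac)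

definition loops :: "'a set \<Rightarrow> 'a \<Rightarrow> 'a list set" where
  "loops C v = {l. l \<noteq> [] \<and> hd l = v \<and> last l = v \<and> set l \<inter> C = {}}"

text \<open>The Green's function at \<open>v\<close> of the chain killed on \<open>C\<close>; the value \<open>1\<close> on \<open>C\<close> makes
  the swap below hold without side conditions.\<close>

definition green :: "'a set \<Rightarrow> 'a \<Rightarrow> ennreal" where
  "green C v = (if v \<in> C then 1 else \<integral>\<^sup>+l. weight l \<partial>count_space (loops C v))"

text \<open>Only the interior \<open>l\<close>, possibly empty, is summed over. It avoids both
  endpoints, so the path leaves \<open>u\<close> for good at its start and reaches \<open>v\<close>
  first at its end.\<close>

definition passage :: "'a set \<Rightarrow> 'a \<Rightarrow> 'a \<Rightarrow> ennreal" where
  "passage C u v = (\<integral>\<^sup>+l. weight (u # l @ [v]) \<partial>count_space {l. set l \<inter> insert u (insert v C) = {}})"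

lemma weight_loop:
  assumes "l \<noteq> []" "hd l = v" "last l = v"
  shows "weight (p @ l @ r) = weight (p @ v # r) * weight l"
proof -
  obtain l' where l': "l = v # l'"
    using assms by (cases l) auto
  obtain m where m: "l = m @ [v]"
    using assms by (metis append_butlast_last_id)
  have "weight (p @ l @ r) = weight (p @ [v]) * weight (l @ r)"
    using weight_append[of p v "l' @ r"] l' by simp
  also have "\<dots> = weight (p @ [v]) * (weight l * weight (v # r))"
    using weight_append[of m v r] m by simp
  finally show ?thesis
    using weight_append[of p v r] by (simp add: mult_ac)
qed

text \<open>Cut \<open>p\<close> at its last visit to \<open>v\<close>: a loop at \<open>v\<close>
  is followed by the interior of a passage from \<open>v\<close> to \<open>u\<close>.\<close>

lemma exit_sum:
  assumes "v \<notin> C" "u \<notin> C" "u \<noteq> v"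
  shows "(\<integral>\<^sup>+p. weight (p @ [u]) \<partial>count_space {p. p \<noteq> [] \<and> hd p = v \<and> set p \<inter> insert u C = {}}) =
    green (insert u C) v * passage C v u"
proof -
  let ?P = "{l. set l \<inter> insert v (insert u C) = {}}"
  let ?g = "\<lambda>(l, q). l @ q"
  let ?S = "{p. p \<noteq> [] \<and> hd p = v \<and> set p \<inter> insert u C = {}}"
  have inj: "inj_on ?g (loops (insert u C) v \<times> ?P)"
  proof (rule inj_onI)
    fix x y assume xy: "x \<in> loops (insert u C) v \<times> ?P" "y \<in> loops (insert u C) v \<times> ?P" "?g x = ?g y"
    obtain l q l' q' where [simp]: "x = (l, q)" "y = (l', q')"
      by (cases x, cases y)
    have l: "l = butlast l @ [v]" "l' = butlast l' @ [v]"
      using xy append_butlast_last_id[of l] append_butlast_last_id[of l'] by (simp_all add: loops_def)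
    have "l @ q = l' @ q'" using xy by simp
    then have "butlast l @ v # q = butlast l' @ v # q'"
      by (subst (asm) l(1), subst (asm) l(2)) simp
    moreover have "v \<notin> set q" "v \<notin> set q'" using xy by auto
    ultimately have "q = q'"
      by (metis after_last_append)
    then show "x = y" using xy by simp
  qed
  have img: "?g ` (loops (insert u C) v \<times> ?P) = ?S"
  proof
    show "?S \<subseteq> ?g ` (loops (insert u C) v \<times> ?P)"
    proof
      fix p assume p: "p \<in> ?S"
      then obtain p' where p': "p = v # p'" by (cases p) auto
      obtain l where l: "v # p' = l @ after_last v p'" "l \<noteq> []" "hd l = v" "last l = v"
        using after_last_split by metis
      have "set p = set l \<union> set (after_last v p')"
        using l(1) p' by (metis set_append)
      then have "(l, after_last v p') \<in> loops (insert u C) v \<times> ?P"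
        using p l notin_after_last[of v p'] by (auto simp: loops_def)
      then show "p \<in> ?g ` (loops (insert u C) v \<times> ?P)"
        using l(1) p' by (intro image_eqI[of _ _ "(l, after_last v p')"]) auto
    qed
  next
    show "?g ` (loops (insert u C) v \<times> ?P) \<subseteq> ?S"
      using assms by (intro image_subsetI, clarify) (simp add: loops_def Int_Un_distrib2 insert_commute)
  qed
  have "(\<integral>\<^sup>+p. weight (p @ [u]) \<partial>count_space ?S) =
      (\<integral>\<^sup>+(l, q). weight l * weight (v # q @ [u]) \<partial>count_space (loops (insert u C) v \<times> ?P))"
    unfolding img[symmetric] nn_integral_count_space_image[OF inj]
  proof (rule nn_integral_cong, clarify)
    fix l q assume "(l, q) \<in> space (count_space (loops (insert u C) v \<times> ?P))"
    then show "weight ((l @ q) @ [u]) = weight l * weight (v # q @ [u])"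
      using weight_loop[of l v "[]" "q @ [u]"] by (simp add: loops_def mult.commute)
  qed
  then show ?thesis
    using assms by (simp add: nn_integral_count_space_times green_def passage_def)
qed

text \<open>Mirror image of \<open>exit_sum\<close>: cut \<open>r\<close> at its first visit to
  \<open>v\<close>.\<close>

lemma entrance_sum:
  assumes "v \<notin> C" "u \<notin> C" "u \<noteq> v"
  shows "(\<integral>\<^sup>+r. weight (u # r) \<partial>count_space {r. r \<noteq> [] \<and> last r = v \<and> set r \<inter> insert u C = {}}) =
    passage C u v * green (insert u C) v"
proof -
  let ?P = "{l. set l \<inter> insert u (insert v C) = {}}"
  let ?g = "\<lambda>(q, l). q @ l"
  let ?S = "{p. p \<noteq> [] \<and> last p = v \<and> set p \<inter> insert u C = {}}"
  have inj: "inj_on ?g (?P \<times> loops (insert u C) v)"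
  proof (rule inj_onI)
    fix x y assume xy: "x \<in> ?P \<times> loops (insert u C) v" "y \<in> ?P \<times> loops (insert u C) v" "?g x = ?g y"
    obtain q l q' l' where [simp]: "x = (q, l)" "y = (q', l')"
      by (cases x, cases y)
    have l: "l = v # tl l" "l' = v # tl l'"
      using xy list.collapse[of l] list.collapse[of l'] by (simp_all add: loops_def)
    have "q @ l = q' @ l'" using xy by simp
    then have "q @ v # tl l = q' @ v # tl l'"
      by (subst (asm) l(1), subst (asm) l(2)) simp
    moreover have "v \<notin> set q" "v \<notin> set q'" using xy by auto
    ultimately have "q = q'"
      by (metis append_Cons_eq_prefix)
    then show "x = y" using xy by simp
  qed
  have img: "?g ` (?P \<times> loops (insert u C) v) = ?S"
  proof
    show "?S \<subseteq> ?g ` (?P \<times> loops (insert u C) v)"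
    proof
      fix p assume p: "p \<in> ?S"
      then have "v \<in> set p" by auto
      then obtain q l where "p = q @ v # l" "v \<notin> set q"
        by (meson split_list_first)
      then have "(q, v # l) \<in> ?P \<times> loops (insert u C) v" "p = ?g (q, v # l)"
        using p by (auto simp: loops_def)
      then show "p \<in> ?g ` (?P \<times> loops (insert u C) v)"
        by (intro image_eqI)
    qed
  next
    show "?g ` (?P \<times> loops (insert u C) v) \<subseteq> ?S"
      using assms by (intro image_subsetI, clarify) (simp add: loops_def Int_Un_distrib2 insert_commute)
  qed
  have "(\<integral>\<^sup>+p. weight (u # p) \<partial>count_space ?S) =
      (\<integral>\<^sup>+(q, l). weight (u # q @ [v]) * weight l \<partial>count_space (?P \<times> loops (insert u C) v))"
    unfolding img[symmetric] nn_integral_count_space_image[OF inj]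
  proof (rule nn_integral_cong, clarify)
    fix q l assume "(q, l) \<in> space (count_space (?P \<times> loops (insert u C) v))"
    then show "weight (u # q @ l) = weight (u # q @ [v]) * weight l"
      using weight_loop[of l v "u # q" "[]"] by (simp add: loops_def)
  qed
  then show ?thesis
    using assms by (simp add: nn_integral_count_space_times green_def passage_def)
qed

lemma nn_integral_erase_singleton_fiber:
  assumes "v \<notin> set p" "v \<notin> set r"
  shows "(\<integral>\<^sup>+w. f w \<partial>count_space {w. erase {v} w = p @ v # r}) =
    (\<integral>\<^sup>+l. f (p @ l @ r) \<partial>count_space {l. l \<noteq> [] \<and> hd l = v \<and> last l = v})"
  using nn_integral_bij_count_space[OF erase_singleton_fiber[OF assms]] by metis

text \<open>Cut a loop at \<open>v\<close> that passes through \<open>u\<close> at its first and last visit to \<open>u\<close>.\<close>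

lemma green_through:
  assumes "v \<notin> C" "u \<notin> C" "u \<noteq> v"
  shows "green C v = green (insert u C) v +
    green (insert u C) v * passage C v u * green C u * passage C u v * green (insert u C) v"
proof -
  let ?p = "{p. p \<noteq> [] \<and> hd p = v \<and> set p \<inter> insert u C = {}}"
  let ?r = "{r. r \<noteq> [] \<and> last r = v \<and> set r \<inter> insert u C = {}}"
  let ?L = "{l \<in> loops C v. u \<in> set l}"
  let ?g = "\<lambda>(p, l, r). p @ l @ r"
  have inj: "inj_on ?g (?p \<times> loops C u \<times> ?r)"
  proof (rule inj_onI)
    fix x y assume xy: "x \<in> ?p \<times> loops C u \<times> ?r" "y \<in> ?p \<times> loops C u \<times> ?r" "?g x = ?g y"
    obtain p l r p' l' r' where [simp]: "x = (p, l, r)" "y = (p', l', r')"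
      by (cases x, cases y)
    have a: "p @ l @ r = p' @ l' @ r'" "l \<in> loops C u" "l' \<in> loops C u"
      "set p \<inter> insert u C = {}" "set p' \<inter> insert u C = {}" "set r \<inter> insert u C = {}" "set r' \<inter> insert u C = {}"
      using xy by auto
    \<comment> \<open>The cut is unique: erasing at \<open>u\<close> recovers \<open>p\<close> and
      \<open>r\<close>, and \<open>l\<close> follows by cancellation.\<close>
    have "erase {u} (p @ l @ r) = p @ u # r"
      using bij_betwE[OF erase_singleton_fiber[of u p r]] a(2,4,6) by (auto simp: loops_def)
    moreover have "erase {u} (p' @ l' @ r') = p' @ u # r'"
      using bij_betwE[OF erase_singleton_fiber[of u p' r']] a(3,5,7) by (auto simp: loops_def)
    ultimately have "p = p'" "r = r'"
      using a append_Cons_eq_iff[of u p r p' r'] by auto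
    then show "x = y" using a by simp
  qed
  have img: "?g ` (?p \<times> loops C u \<times> ?r) = ?L"
  proof
    show "?L \<subseteq> ?g ` (?p \<times> loops C u \<times> ?r)"
    proof
      fix w assume w: "w \<in> ?L"
      then have "u \<in> set w" by simp
      then obtain p q where q: "w = p @ u # q" "u \<notin> set p"
        by (meson split_list_first)
      obtain l where l: "u # q = l @ after_last u q" "l \<noteq> []" "hd l = u" "last l = u"
        using after_last_split by metis
      let ?a = "after_last u q"
      have w': "w = p @ l @ ?a" using q l by simp
      \<comment> \<open>The loop \<open>w\<close> starts and ends at \<open>v\<close>, whereas
        \<open>l\<close> starts and ends at \<open>u\<close>, which differs from
        \<open>v\<close>.\<close>
      have "p \<noteq> []" "?a \<noteq> []"
        using w w' assms l by (auto simp: loops_def)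
      then have "(p, l, ?a) \<in> ?p \<times> loops C u \<times> ?r"
        using w w' l q notin_after_last[of u q] assms(3) unfolding loops_def
        by simp blast
      then show "w \<in> ?g ` (?p \<times> loops C u \<times> ?r)"
        using w' by (intro image_eqI[of _ _ "(p, l, ?a)"]) auto
    qed
  next
    show "?g ` (?p \<times> loops C u \<times> ?r) \<subseteq> ?L"
    proof (rule image_subsetI)
      fix x assume x: "x \<in> ?p \<times> loops C u \<times> ?r"
      obtain p l r where [simp]: "x = (p, l, r)"
        by (cases x)
      show "?g x \<in> ?L"
        using x assms hd_in_set[of l] by (auto simp: loops_def)
    qed
  qed
  have "(\<integral>\<^sup>+w. weight w \<partial>count_space ?L) =
     (\<integral>\<^sup>+(p, lr). weight (p @ [u]) * (case lr of (l, r) \<Rightarrow> weight l * weight (u # r)) \<partial>count_space (?p \<times> loops C u \<times> ?r))"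
    unfolding img[symmetric] nn_integral_count_space_image[OF inj]
  proof (rule nn_integral_cong)
    fix x assume x: "x \<in> space (count_space (?p \<times> loops C u \<times> ?r))"
    obtain p l r where [simp]: "x = (p, l, r)"
      by (cases x)
    show "weight (?g x) = (case x of (p, lr) \<Rightarrow> weight (p @ [u]) * (case lr of (l, r) \<Rightarrow> weight l * weight (u # r)))"
      using x weight_loop[of l u p r] weight_append[of p u r] by (simp add: loops_def mult_ac)
  qed
  also have "\<dots> = green (insert u C) v * passage C v u * green C u * passage C u v * green (insert u C) v"
    unfolding nn_integral_count_space_times exit_sum[OF assms] entrance_sum[OF assms]
    using assms by (simp add: green_def mult_ac)
  finally have L: "(\<integral>\<^sup>+w. weight w \<partial>count_space ?L) = \<dots>" .
  have "loops C v = loops (insert u C) v \<union> ?L" "loops (insert u C) v \<inter> ?L = {}"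
    by (auto simp: loops_def)
  then show ?thesis
    using L assms nn_integral_count_space_Un_disjoint[of "loops (insert u C) v" ?L weight]
    by (simp add: green_def)
qed

text \<open>Both sides solve \<open>x = c + r y\<close>, \<open>y = c + r x\<close>, which forces \<open>x = y\<close> by monotonicity,
  even if the values are infinite.\<close>

lemma green_swap: "green C u * green (insert u C) v = green C v * green (insert v C) u"
proof (cases "u = v \<or> u \<in> C \<or> v \<in> C")
  case True
  then show ?thesis by (auto simp: green_def insert_absorb)
next
  case False
  \<comment> \<open>\<open>c\<close> is symmetric in \<open>u\<close> and \<open>v\<close>; the
    ratio \<open>r\<close> of the two equations is
    \<open>passage C v u * passage C u v * c\<close>.\<close>
  define c where "c = green (insert u C) v * green (insert v C) u"

  define x where "x = green C u * green (insert u C) v"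
  define y where "y = green C v * green (insert v C) u"
  have x: "x = c + passage C v u * passage C u v * c * y"
    using green_through[of u C v] False unfolding x_def y_def c_def
    by (auto simp: distrib_right distrib_left mult_ac)
  have y: "y = c + passage C v u * passage C u v * c * x"
    using green_through[of v C u] False unfolding x_def y_def c_def
    by (auto simp: distrib_right distrib_left mult_ac)
  have "x = y"
  proof (cases "x \<le> y")
    case True
    then have "y \<le> x"
      by (subst x, subst y) (intro add_left_mono mult_left_mono; simp)
    with True show ?thesis by simp
  next
    case False
    then have "x \<le> y"
      by (subst x, subst y) (intro add_left_mono mult_left_mono; simp)
    with False show ?thesis by simp
  qed
  then show ?thesis by (simp add: x_def y_def)
qed

end

section \<open>The law of partially erased paths\<close>

text \<open>The fold carries the killed set along with the product, since each factor depends on the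
  points taken before it.\<close>

definition green_set :: "('a \<Rightarrow> 'a \<Rightarrow> ennreal) \<Rightarrow> 'a set \<Rightarrow> 'a set \<Rightarrow> ennreal" where
  "green_set k C S = snd (Finite_Set.fold (\<lambda>v (C, a). (insert v C, a * green k C v)) (C, 1) S)"

lemma green_set_empty [simp]: "green_set k C {} = 1"
  by (simp add: green_set_def)

text \<open>Exchanging two consecutive points is exactly \<open>green_swap\<close>; hence the fold
  over a finite set does not depend on the order.\<close>

interpretation green_set: comp_fun_commute "\<lambda>v (C, a). (insert v C, a * green k C v)"
  for k :: "'a \<Rightarrow> 'a \<Rightarrow> ennreal"
proof
  fix u v :: 'a
  show "(\<lambda>(C, a). (insert v C, a * green k C v)) \<circ> (\<lambda>(C, a). (insert u C, a * green k C u)) =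
      (\<lambda>(C, a). (insert u C, a * green k C u)) \<circ> (\<lambda>(C, a). (insert v C, a * green k C v))"
    using green_swap[of k _ u v] by (auto simp: fun_eq_iff insert_commute mult.assoc)
qed

lemma green_set_insert:
  assumes "finite S" "v \<notin> S"
  shows "green_set k C (insert v S) = green k C v * green_set k (insert v C) S"
proof -
  \<comment> \<open>The initial product only scales the result. With \<open>fold_insert2\<close> the
    new point acts on the initial state, so it is the first one taken.\<close>
  have scale: "snd (Finite_Set.fold (\<lambda>v (C, a). (insert v C, a * green k C v)) (C, a) S) =
      a * green_set k C S" if "finite S" for a C S
    using that
  proof (induction S arbitrary: C a)
    case (insert u S)
    have "snd (Finite_Set.fold (\<lambda>v (C, a). (insert v C, a * green k C v)) (C, b) (insert u S)) =
        b * green k C u * green_set k (insert u C) S" for b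
      using insert.hyps insert.IH[of "insert u C" "b * green k C u"]
      by (simp add: green_set.fold_insert2 del: green_set.fold_insert)
    from this[of a] this[of 1] show ?case
      by (simp add: green_set_def[of k C] mult.assoc del: green_set.fold_insert)
  qed (simp add: green_set_def)
  show ?thesis
    using assms scale[OF assms(1), of "insert v C" "green k C v"]
    by (simp add: green_set_def green_set.fold_insert2 del: green_set.fold_insert)
qed

lemma green_set_Un:
  "finite S \<Longrightarrow> finite T \<Longrightarrow> S \<inter> T = {} \<Longrightarrow>
    green_set k C (S \<union> T) = green_set k C S * green_set k (C \<union> S) T"
proof (induction S arbitrary: C rule: finite_induct)
  case (insert v S)
  then show ?case
    by (simp add: green_set_insert mult.assoc)
qed simp

text \<open>Here \<open>v\<close> is taken last instead of first, so its Green's function is killed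
  on all of \<open>S\<close> as well.\<close>

lemma green_set_insert_right:
  assumes "finite S" "v \<notin> S"
  shows "green_set k C (insert v S) = green_set k C S * green k (C \<union> S) v"
  using green_set_Un[of S "{v}" k C] assms by (simp add: green_set_insert)

text \<open>The total weight of all paths avoiding \<open>C\<close> that \<open>erase U\<close> maps to \<open>l\<close>.\<close>

definition erased_weight ::
    "('a \<Rightarrow> 'a \<Rightarrow> ennreal) \<Rightarrow> 'a set \<Rightarrow> 'a set \<Rightarrow> 'a list \<Rightarrow> ennreal" where
  "erased_weight k C U l =
    (if set l \<inter> C = {} \<and> simple_in U l then weight k l * green_set k C (U \<inter> set l) else 0)"

lemma erased_weight_empty: "erased_weight k C {} l = (if set l \<inter> C = {} then weight k l else 0)"
  by (simp add: erased_weight_def simple_in_def)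

lemma erased_weight_disjoint:
  assumes "set l \<inter> W = {}"
  shows "erased_weight k C (U \<union> W) l = erased_weight k C U l"
proof -
  have "filter (\<lambda>a. a \<in> U \<union> W) l = filter (\<lambda>a. a \<in> U) l"
    using assms by (intro filter_cong) auto
  moreover have "(U \<union> W) \<inter> set l = U \<inter> set l"
    using assms by auto
  ultimately show ?thesis
    by (simp only: erased_weight_def simple_in_def)
qed

text \<open>The fiber over \<open>p @ v # q\<close> consists of the paths \<open>p @ l @ q\<close>
  with a loop \<open>l\<close> at \<open>v\<close>, and the weight factors into a constant and a
  weight of \<open>l\<close>. The assumption on loops is for every killed set because the points of
  \<open>U\<close> on \<open>p\<close> and \<open>q\<close> join it;
  \<open>erased_weight_loops\<close> supplies it.\<close>

lemma erased_weight_erase_point: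
  fixes k :: "'a \<Rightarrow> 'a \<Rightarrow> ennreal"
  assumes v: "v \<notin> U"
    and loops: "\<And>C. v \<notin> C \<Longrightarrow> (\<integral>\<^sup>+l. erased_weight k C U l \<partial>count_space (loops {} v)) = green k C v"
  shows "(\<integral>\<^sup>+w. erased_weight k C U w \<partial>count_space {w. erase {v} w = r}) =
    erased_weight k C (insert v U) r"
proof (cases "v \<in> set r")
  case False
  then have "{w. erase {v} w = r} = {r}"
    by (simp add: erase_notin_fiber)
  then show ?thesis
    using False erased_weight_disjoint[of r "{v}" k C U] by (simp add: nn_integral_count_space_singleton)
next
  case True
  then obtain p q where r: "r = p @ v # q" "v \<notin> set p"
    by (meson split_list_first)
  show ?thesis
  proof (cases "v \<in> set q \<or> v \<in> C")
    case True
    \<comment> \<open>Both sides vanish: a second \<open>v\<close> on the target makes the fiber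
      empty, and if \<open>v\<close> lies in \<open>C\<close>, every path in the fiber meets
      \<open>C\<close>.\<close>
    have "erased_weight k C U w = 0" if w: "erase {v} w = r" for w
    proof -
      have "v \<notin> set q"
        using count_erase_singleton[of v w] r w by (auto simp: count_list_0_iff)
      then have "v \<in> C" "v \<in> set w"
        using True set_erase[of "{v}" w] r w by auto
      then show ?thesis by (auto simp: erased_weight_def)
    qed
    then have "(\<integral>\<^sup>+w. erased_weight k C U w \<partial>count_space {w. erase {v} w = r}) =
        (\<integral>\<^sup>+w. 0 \<partial>count_space {w. erase {v} w = r})"
      by (intro nn_integral_cong) simp
    moreover have "erased_weight k C (insert v U) r = 0"
      using True r by (auto simp: erased_weight_def simple_in_def)
    ultimately show ?thesis by simp
  next
    case False
    let ?S = "U \<inter> (set p \<union> set q)"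
    \<comment> \<open>The factor that does not depend on the inserted loop.\<close>
    define c where "c = (if (set p \<union> set q) \<inter> C = {} \<and> simple_in U (p @ q)
      then weight k (p @ v # q) * green_set k C ?S else 0)"
    have l: "erased_weight k C U (p @ l @ q) = c * erased_weight k (C \<union> ?S) U l" if "l \<in> loops {} v" for l
    proof -
      \<comment> \<open>A point of \<open>U\<close> may be visited once in total, so the loop must
        avoid \<open>?S\<close>, as if the chain were killed there.\<close>
      have iff: "set (p @ l @ q) \<inter> C = {} \<and> simple_in U (p @ l @ q) \<longleftrightarrow>
          ((set p \<union> set q) \<inter> C = {} \<and> simple_in U (p @ q)) \<and> (set l \<inter> (C \<union> ?S) = {} \<and> simple_in U l)"
        unfolding simple_in_def by auto
      show ?thesis
      proof (cases "set (p @ l @ q) \<inter> C = {} \<and> simple_in U (p @ l @ q)")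
        case True
        have "U \<inter> set (p @ l @ q) = ?S \<union> (U \<inter> set l)" by auto
        moreover have "?S \<inter> (U \<inter> set l) = {}"
          using iff True by auto
        ultimately have "green_set k C (U \<inter> set (p @ l @ q)) =
            green_set k C ?S * green_set k (C \<union> ?S) (U \<inter> set l)"
          by (simp add: green_set_Un)
        moreover have "weight k (p @ l @ q) = weight k (p @ v # q) * weight k l"
          using that by (intro weight_loop) (auto simp: loops_def)
        ultimately show ?thesis
          using True iff unfolding erased_weight_def c_def by (simp add: mult_ac del: set_append)
      qed (use iff in \<open>auto simp: erased_weight_def c_def\<close>)
    qed
    have "(\<integral>\<^sup>+w. erased_weight k C U w \<partial>count_space {w. erase {v} w = r}) =
        (\<integral>\<^sup>+l. erased_weight k C U (p @ l @ q) \<partial>count_space (loops {} v))"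
      using nn_integral_erase_singleton_fiber[of v p q] r False by (simp add: loops_def)
    also have "\<dots> = (\<integral>\<^sup>+l. c * erased_weight k (C \<union> ?S) U l \<partial>count_space (loops {} v))"
      by (intro nn_integral_cong) (simp add: l)
    also have "\<dots> = c * green k (C \<union> ?S) v"
      using v False by (simp add: nn_integral_cmult loops)
    also have "\<dots> = erased_weight k C (insert v U) r"
    proof -
      have "set r \<inter> C = {} \<and> simple_in (insert v U) r \<longleftrightarrow>
          (set p \<union> set q) \<inter> C = {} \<and> simple_in U (p @ q)"
      proof -
        have "filter (\<lambda>a. a = v \<or> a \<in> U) s = filter (\<lambda>a. a \<in> U) s" if "v \<notin> set s" for s
          using that by (intro filter_cong) auto
        then show ?thesis
          using r False v by (auto simp: simple_in_def)
      qed
      moreover have "insert v U \<inter> set r = insert v ?S"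
        using r by auto
      moreover have "green_set k C (insert v ?S) = green_set k C ?S * green k (C \<union> ?S) v"
        using v by (intro green_set_insert_right) auto
      ultimately show ?thesis
        by (simp add: erased_weight_def c_def r(1) mult_ac)
    qed
    finally show ?thesis .
  qed
qed

text \<open>Erasing at one more point \<open>u\<close> moves mass only among the loops at
  \<open>v\<close>, because erasure keeps both endpoints. The induction hypothesis is used at
  \<open>u\<close>, for all killed sets, to justify that erasure, and then at \<open>v\<close> for
  the total mass.\<close>

lemma erased_weight_loops:
  "finite U \<Longrightarrow> v \<notin> U \<Longrightarrow> v \<notin> C \<Longrightarrow>
    (\<integral>\<^sup>+l. erased_weight k C U l \<partial>count_space (loops {} v)) = green k C v"
proof (induction U arbitrary: C v rule: finite_induct)
  case empty
  have "(\<integral>\<^sup>+l. erased_weight k C {} l \<partial>count_space (loops {} v)) = (\<integral>\<^sup>+l. weight k l \<partial>count_space (loops C v))"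
    by (subst (1 2) nn_integral_count_space_indicator, simp, simp)
      (auto intro!: nn_integral_cong simp: loops_def erased_weight_empty split: split_indicator)
  then show ?case using empty by (simp add: green_def)
next
  case (insert u U)
  have "(\<integral>\<^sup>+l. erased_weight k C (insert u U) l \<partial>count_space (loops {} v)) =
      (\<integral>\<^sup>+l. (\<integral>\<^sup>+w. erased_weight k C U w \<partial>count_space {w \<in> UNIV. erase {u} w = l}) \<partial>count_space (loops {} v))"
    using insert by (simp add: erased_weight_erase_point)
  also have "\<dots> = (\<integral>\<^sup>+w. erased_weight k C U w \<partial>count_space {w \<in> UNIV. erase {u} w \<in> loops {} v})"
    by (rule nn_integral_count_space_fibers)
  also have "{w \<in> UNIV. erase {u} w \<in> loops {} v} = loops {} v"
    by (auto simp: loops_def hd_erase last_erase)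
  finally show ?case using insert by simp
qed

text \<open>Peel off the first point of \<open>W\<close> on the target \<open>r\<close>. The order
  of peeling depends on \<open>r\<close>, but the resulting formula does not.\<close>

lemma erased_weight_erase_disjoint:
  fixes k :: "'a \<Rightarrow> 'a \<Rightarrow> ennreal"
  shows "finite W \<Longrightarrow> finite U \<Longrightarrow> U \<inter> W = {} \<Longrightarrow>
    (\<integral>\<^sup>+w. erased_weight k C U w \<partial>count_space {w. erase W w = r}) = erased_weight k C (U \<union> W) r"
proof (induction W arbitrary: U rule: finite_psubset_induct)
  case (psubset W)
  show ?case
  proof (cases "find (\<lambda>a. a \<in> W) r")
    case None
    then have "set r \<inter> W = {}"
      by (auto simp: find_None_iff)
    then show ?thesis
      by (simp add: erase_notin_fiber nn_integral_count_space_singleton erased_weight_disjoint)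
  next
    case (Some v)
    then have v: "v \<in> W"
      by (auto simp: find_Some_iff)
    have "(\<integral>\<^sup>+w. erased_weight k C U w \<partial>count_space {w. erase W w = r}) =
        (\<integral>\<^sup>+w. erased_weight k C U w \<partial>count_space {w \<in> UNIV. erase {v} w \<in> {y. erase (W - {v}) y = r}})"
      by (simp add: erase_eq_iff_peel[OF Some])
    also have "\<dots> = (\<integral>\<^sup>+y. (\<integral>\<^sup>+w. erased_weight k C U w \<partial>count_space {w \<in> UNIV. erase {v} w = y})
        \<partial>count_space {y. erase (W - {v}) y = r})"
      by (rule nn_integral_count_space_fibers[symmetric])
    also have "\<dots> = (\<integral>\<^sup>+y. erased_weight k C (insert v U) y \<partial>count_space {y. erase (W - {v}) y = r})"
      using v psubset.prems erased_weight_loops[of U v _ k]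
      by (subst erased_weight_erase_point[symmetric, of v U k C]) auto
    also have "\<dots> = erased_weight k C (insert v U \<union> (W - {v})) r"
      using v psubset.prems by (intro psubset.IH) auto
    also have "insert v U \<union> (W - {v}) = U \<union> W"
      using v by auto
    finally show ?thesis .
  qed
qed

text \<open>The weight charges only paths that are simple in \<open>U\<close>, and on these erasing
  \<open>W\<close> is the same as erasing \<open>W - U\<close>.\<close>

lemma erased_weight_erase:
  assumes "finite W" "U \<subseteq> W"
  shows "(\<integral>\<^sup>+w. erased_weight k C U w \<partial>count_space {w. erase W w = r}) = erased_weight k C W r"
proof -
  have "(\<integral>\<^sup>+w. erased_weight k C U w \<partial>count_space {w. erase W w = r}) =
      (\<integral>\<^sup>+w. erased_weight k C U w \<partial>count_space {w. erase (W - U) w = r})"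
  proof -
    have "erased_weight k C U w * indicator {w. erase W w = r} w =
        erased_weight k C U w * indicator {w. erase (W - U) w = r} w" for w
      using erase_simple_in[of U w W]
      by (cases "simple_in U w") (simp_all add: erased_weight_def indicator_def)
    then show ?thesis
      by (subst (1 2) nn_integral_count_space_indicator) simp_all
  qed
  also have "\<dots> = erased_weight k C (U \<union> (W - U)) r"
    using assms by (intro erased_weight_erase_disjoint) (auto intro: finite_subset)
  also have "U \<union> (W - U) = W"
    using assms by auto
  finally show ?thesis .
qed

section \<open>Erasing along an increasing sequence of sets\<close>

primrec iterated_erase :: "(nat \<Rightarrow> 'a set) \<Rightarrow> nat \<Rightarrow> 'a list \<Rightarrow> 'a list" where
  "iterated_erase W 0 w = w"
| "iterated_erase W (Suc n) w = erase (W (Suc n)) (iterated_erase W n w)"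

text \<open>Sum over the path obtained after \<open>m\<close> erasures. The convention
  \<open>W 0 = {}\<close> makes the unerased weight the base case.\<close>

lemma erased_weight_iterated_erase:
  assumes "\<And>i. i < m \<Longrightarrow> W i \<subseteq> W (Suc i)" "W 0 = {}" "finite (W m)"
  shows "(\<integral>\<^sup>+w. weight k w \<partial>count_space {w. iterated_erase W m w = r}) = erased_weight k {} (W m) r"
  using assms
proof (induction m arbitrary: r)
  case 0
  then show ?case
    by (simp add: nn_integral_count_space_singleton erased_weight_empty)
next
  case (Suc m)
  have sub: "W m \<subseteq> W (Suc m)"
    using Suc.prems by simp
  have "(\<integral>\<^sup>+w. weight k w \<partial>count_space {w. iterated_erase W (Suc m) w = r}) =
      (\<integral>\<^sup>+w. weight k w \<partial>count_space {w \<in> UNIV. iterated_erase W m w \<in> {y. erase (W (Suc m)) y = r}})"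
    by simp
  also have "\<dots> = (\<integral>\<^sup>+y. (\<integral>\<^sup>+w. weight k w \<partial>count_space {w \<in> UNIV. iterated_erase W m w = y})
      \<partial>count_space {y. erase (W (Suc m)) y = r})"
    by (rule nn_integral_count_space_fibers[symmetric])
  also have "\<dots> = (\<integral>\<^sup>+y. erased_weight k {} (W m) y \<partial>count_space {y. erase (W (Suc m)) y = r})"
    using Suc finite_subset[OF sub] by simp
  also have "\<dots> = erased_weight k {} (W (Suc m)) r"
    using Suc.prems sub by (intro erased_weight_erase) auto
  finally show ?case .
qed

text \<open>Both image measures have the point masses \<open>erased_weight k {} (W m)\<close>;
  summing them over \<open>R\<close> gives the claim.\<close>

lemma weight_iterated_erase:
  assumes "\<And>i. i < m \<Longrightarrow> W i \<subseteq> W (Suc i)" "W 0 = {}" "finite (W m)"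
  shows "(\<integral>\<^sup>+w. weight k w \<partial>count_space {w. iterated_erase W m w \<in> R}) =
    (\<integral>\<^sup>+w. weight k w \<partial>count_space {w. erase (W m) w \<in> R})"
proof -
  have "(\<integral>\<^sup>+w. weight k w \<partial>count_space {w. f w \<in> R}) = (\<integral>\<^sup>+r. erased_weight k {} (W m) r \<partial>count_space R)"
    if "\<And>r. (\<integral>\<^sup>+w. weight k w \<partial>count_space {w. f w = r}) = erased_weight k {} (W m) r" for f
    using nn_integral_count_space_fibers[where f = "weight k" and S = UNIV and h = f and T = R]
    by (simp add: that)
  note this[of "iterated_erase W m"] this[of "erase (W m)"]
  moreover have "(\<integral>\<^sup>+w. weight k w \<partial>count_space {w. erase (W m) w = r}) = erased_weight k {} (W m) r" for r
    using erased_weight_erase[where W = "W m" and U = "{}" and k = k and C = "{}" and r = r] assms by (simp add: erased_weight_empty)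
  ultimately show ?thesis
    using erased_weight_iterated_erase[OF assms] by simp
qed

section \<open>Paths of the Markov chain\<close>

lemma weight_eq_prod: "weight k w = (\<Prod>i<length w - 1. k (w ! i) (w ! Suc i))"
proof (induction w rule: weight.induct)
  case (1 a b l)
  then show ?case
    by (simp add: prod.lessThan_Suc_shift del: prod.lessThan_Suc)
qed auto

lemma hitting_time_eq:
  assumes "X n \<omega> \<in> A" "\<And>i. i < n \<Longrightarrow> X i \<omega> \<notin> A"
  shows "hitting_time X A \<omega> = enat n"
  unfolding hitting_time_def
proof (rule antisym)
  show "enat n \<le> Inf (enat ` {n. X n \<omega> \<in> A})"
    using assms(2) by (intro Inf_greatest) (force simp: not_less[symmetric])
qed (use assms(1) in \<open>auto intro: Inf_lower\<close>)

lemma hitting_time_finiteE: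
  assumes "hitting_time X A \<omega> < \<infinity>"
  obtains n where "hitting_time X A \<omega> = enat n" "X n \<omega> \<in> A" "\<And>i. i < n \<Longrightarrow> X i \<omega> \<notin> A"
proof -
  have "\<exists>n. X n \<omega> \<in> A"
    using assms by (intro ccontr[of "Ex _"]) (simp add: hitting_time_def top_enat_def)
  then obtain n where "X n \<omega> \<in> A" "\<And>i. i < n \<Longrightarrow> X i \<omega> \<notin> A"
    using exists_least_iff[of "\<lambda>n. X n \<omega> \<in> A"] by blast
  then show thesis
    using that hitting_time_eq by metis
qed

definition hitting_paths :: "'a set \<Rightarrow> 'a set \<Rightarrow> 'a list set" where
  "hitting_paths V A = {w. w \<noteq> [] \<and> set w \<subseteq> V \<and> last w \<in> A \<and> set (butlast w) \<inter> A = {}}"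

text \<open>Turns an event about the stopped path into a cylinder event, whose probability follows
  from the Markov property.\<close>

lemma path_until_hit_eq_iff:
  assumes "\<And>n. X n \<omega> \<in> V"
  shows "hitting_time X A \<omega> < \<infinity> \<and> path_until_hit X A \<omega> = w \<longleftrightarrow>
    w \<in> hitting_paths V A \<and> (\<forall>i<length w. X i \<omega> = w ! i)"
proof
  assume *: "hitting_time X A \<omega> < \<infinity> \<and> path_until_hit X A \<omega> = w"
  then obtain n where n: "hitting_time X A \<omega> = enat n" "X n \<omega> \<in> A" "\<And>i. i < n \<Longrightarrow> X i \<omega> \<notin> A"
    using hitting_time_finiteE by metis
  have w: "w = map (\<lambda>n. X n \<omega>) [0..<n] @ [X n \<omega>]"
    using * n(1) by (simp add: path_until_hit_def)
  then have "w ! i = X i \<omega>" if "i < length w" for i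
    using that by (auto simp: nth_append less_Suc_eq)
  moreover have "w \<in> hitting_paths V A"
    using n assms by (auto simp: w hitting_paths_def)
  ultimately show "w \<in> hitting_paths V A \<and> (\<forall>i<length w. X i \<omega> = w ! i)"
    by simp
next
  assume *: "w \<in> hitting_paths V A \<and> (\<forall>i<length w. X i \<omega> = w ! i)"
  define n where "n = length w - 1"
  have len: "length w = Suc n"
    using * by (cases w) (auto simp: n_def hitting_paths_def)
  have "last w = w ! n"
    using len last_conv_nth[of w] by (cases "w = []") simp_all
  then have "X n \<omega> \<in> A"
    using * len by (simp add: hitting_paths_def)
  moreover have "X i \<omega> \<notin> A" if "i < n" for i
  proof -
    have "butlast w ! i \<in> set (butlast w)"
      using that len by (intro nth_mem) simp
    then show ?thesis
      using * that len by (auto simp: hitting_paths_def nth_butlast)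
  qed
  ultimately have "hitting_time X A \<omega> = enat n"
    by (rule hitting_time_eq)
  moreover have "map (\<lambda>n. X n \<omega>) [0..<Suc n] = w"
    using * len by (intro nth_equalityI) (auto simp del: upt_Suc)
  ultimately show "hitting_time X A \<omega> < \<infinity> \<and> path_until_hit X A \<omega> = w"
    by (simp add: path_until_hit_def del: upt_Suc)
qed

text \<open>Nonemptiness is carried through the induction because the agreement with
  \<open>erase\<close> is stated for nonempty lists. The two sequences may differ at index 0, which
  neither iteration reads.\<close>

lemma partial_loop_erasure_iterated:
  assumes "w \<noteq> []" "W 0 = {}" "\<And>i. i \<ge> 1 \<Longrightarrow> W i = W' i"
  shows "iterated_ple W' m w = iterated_erase W m w \<and> iterated_erase W m w \<noteq> []"
  using assms by (induction m) (simp_all add: partial_loop_erasure_eq_erase)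

section \<open>Law of the stopped path in terms of weights\<close>

context markov_chain
begin

text \<open>Points of \<open>A\<close> can be entered but not left. Transitions involving points
  outside \<open>V\<close> get weight 0, so sums may range over all lists of the type.\<close>

definition killed_kernel :: "'a set \<Rightarrow> 'a \<Rightarrow> 'a \<Rightarrow> ennreal" where
  "killed_kernel A x y = (if x \<in> V - A \<and> y \<in> V then ennreal (P x y) else 0)"

lemma P_nonneg: "x \<in> V \<Longrightarrow> y \<in> V \<Longrightarrow> 0 \<le> P x y"
  using kernel by (auto simp: markov_kernel_def)

lemma sets_X_eq:
  assumes "x \<in> V"
  shows "{\<omega> \<in> space (PP x). X i \<omega> = y} \<in> sets (PP x)"
proof -
  have "X i \<in> measurable (PP x) (count_space V)"
    using process_measurable[of i] measurable_cong_sets[OF sets_PP[OF assms] refl] by blast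
  then have "X i -` ({y} \<inter> V) \<inter> space (PP x) \<in> sets (PP x)" "\<And>\<omega>. \<omega> \<in> space (PP x) \<Longrightarrow> X i \<omega> \<in> V"
    using measurable_sets[of "X i" "PP x" "count_space V" "{y} \<inter> V"] measurable_space[of "X i" "PP x" "count_space V"]
    by simp_all
  moreover from this(2) have "{\<omega> \<in> space (PP x). X i \<omega> = y} = X i -` ({y} \<inter> V) \<inter> space (PP x)"
    by auto
  ultimately show ?thesis by simp
qed

lemma X_in_V:
  assumes "x \<in> V" "\<omega> \<in> space (PP x)"
  shows "X i \<omega> \<in> V"
  using assms process_measurable[of i] sets_eq_imp_space_eq[OF sets_PP[OF assms(1)]]
  by (auto dest: measurable_space)

lemma sets_X_path:
  assumes "x \<in> V"
  shows "{\<omega> \<in> space (PP x). \<forall>i<n. X i \<omega> = f i} \<in> sets (PP x)"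
  using sets.sets_Collect_finite_All'[of "{..<n}" "PP x" "\<lambda>i \<omega>. X i \<omega> = f i"] sets_X_eq[OF assms]
  by (cases "n = 0") (auto simp: lessThan_def)

lemma measure_X_path:
  assumes x: "x \<in> V" and "\<And>i. i \<le> n \<Longrightarrow> f i \<in> V"
  shows "measure (PP x) {\<omega> \<in> space (PP x). \<forall>i\<le>n. X i \<omega> = f i} =
    (if f 0 = x then (\<Prod>i<n. P (f i) (f (Suc i))) else 0)"
  using assms(2)
proof (induction n)
  case 0
  interpret prob_space "PP x" using prob_spaces[OF x] .
  have X0: "AE \<omega> in PP x. X 0 \<omega> = x"
    using start[OF x] sets_X_eq[OF x, of 0 x] by (simp add: prob_Collect_eq_1)
  show ?case
  proof (cases "f 0 = x")
    case True
    then show ?thesis using start[OF x] by simp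
  next
    case False
    have "AE \<omega> in PP x. X 0 \<omega> \<noteq> f 0"
      using X0 by eventually_elim (use False in auto)
    then show ?thesis
      using False sets_X_eq[OF x, of 0 "f 0"] by (simp add: prob_Collect_eq_0)
  qed
next
  case (Suc n)
  interpret prob_space "PP x" using prob_spaces[OF x] .
  let ?E = "\<lambda>n. {\<omega> \<in> space (PP x). \<forall>i\<le>n. X i \<omega> = f i}"
  have IH: "measure (PP x) (?E n) = (if f 0 = x then (\<Prod>i<n. P (f i) (f (Suc i))) else 0)"
    using Suc by simp
  have step: "measure (PP x) (?E (Suc n)) = P (f n) (f (Suc n)) * measure (PP x) (?E n)"
  \<comment> \<open>The Markov property is assumed only for conditioning events of positive
    probability; on a null event both sides vanish by monotonicity.\<close>
  proof (cases "measure (PP x) (?E n) = 0")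
    case True
    have "measure (PP x) (?E (Suc n)) \<le> measure (PP x) (?E n)"
      using sets_X_path[OF x, of "Suc n" f] unfolding less_Suc_eq_le
      by (rule finite_measure_mono[rotated]) auto
    then show ?thesis using True by (simp add: measure_le_0_iff)
  next
    case False
    then have "\<P>(\<omega> in PP x. X (Suc n) \<omega> = f (Suc n) \<bar> \<forall>i\<le>n. X i \<omega> = f i) = P (f n) (f (Suc n))"
      using x Suc.prems by (intro markov_property) (simp_all add: zero_less_measure_iff)
    moreover have "{\<omega> \<in> space (PP x). X (Suc n) \<omega> = f (Suc n) \<and> (\<forall>i\<le>n. X i \<omega> = f i)} = ?E (Suc n)"
      by (auto simp: le_Suc_eq)
    ultimately show ?thesis
      using False by (simp add: cond_prob_def field_simps)
  qed
  show ?case unfolding step IH by simp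
qed

text \<open>Such a list leaves \<open>V\<close> or meets \<open>A\<close> before its end, and the
  corresponding transition has weight 0.\<close>

lemma weight_killed_eq_0:
  assumes "w \<noteq> []" "hd w \<in> V" "last w \<in> A" "w \<notin> hitting_paths V A"
  shows "weight (killed_kernel A) w = 0"
  using assms
proof (induction w rule: weight.induct)
  case (1 a b l)
  then show ?case
    by (cases "a \<in> A \<or> b \<notin> V") (auto simp: hitting_paths_def killed_kernel_def)
qed (auto simp: hitting_paths_def)

lemma emeasure_X_path:
  assumes x: "x \<in> V" and w: "w \<in> hitting_paths V A"
  shows "emeasure (PP x) {\<omega> \<in> space (PP x). \<forall>i<length w. X i \<omega> = w ! i} =
    (if hd w = x then weight (killed_kernel A) w else 0)"
proof -
  interpret prob_space "PP x" using prob_spaces[OF x] .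
  define n where "n = length w - 1"
  have len: "length w = Suc n"
    using w by (cases w) (auto simp: n_def hitting_paths_def)
  have V: "w ! i \<in> V" if "i \<le> n" for i
    using w that len nth_mem[of i w] by (auto simp: hitting_paths_def)
  have A: "w ! i \<notin> A" if "i < n" for i
  proof -
    have "butlast w ! i \<in> set (butlast w)"
      using that len by (intro nth_mem) simp
    then show ?thesis
      using w that len by (auto simp: hitting_paths_def nth_butlast)
  qed
  have "emeasure (PP x) {\<omega> \<in> space (PP x). \<forall>i<length w. X i \<omega> = w ! i} =
      ennreal (if w ! 0 = x then (\<Prod>i<n. P (w ! i) (w ! Suc i)) else 0)"
    using measure_X_path[OF x, of n "(!) w"] V by (simp add: emeasure_eq_measure len less_Suc_eq_le)
  moreover have "w ! 0 = hd w"
    using len by (intro hd_conv_nth[symmetric]) auto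
  moreover have "ennreal (\<Prod>i<n. P (w ! i) (w ! Suc i)) = weight (killed_kernel A) w"
    unfolding weight_eq_prod n_def[symmetric]
    by (subst prod_ennreal[symmetric]) (auto simp: killed_kernel_def V A P_nonneg intro!: prod.cong)
  ultimately show ?thesis by simp
qed

text \<open>Besides \<open>R\<close>, the index set restricts only the endpoints, since all other
  lists have weight 0. Erasure preserves endpoints, so this form can be transferred to erased
  paths.\<close>

lemma emeasure_path_until_hit:
  assumes x: "x \<in> V"
  shows "emeasure (PP x) {\<omega> \<in> space (PP x). hitting_time X A \<omega> < \<infinity> \<and> path_until_hit X A \<omega> \<in> R} =
    (\<integral>\<^sup>+w. weight (killed_kernel A) w \<partial>count_space {w \<in> R. w \<noteq> [] \<and> hd w = x \<and> last w \<in> A})"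
proof -
  let ?E = "\<lambda>w. {\<omega> \<in> space (PP x). \<forall>i<length w. X i \<omega> = w ! i}"
  let ?I = "hitting_paths V A \<inter> R"
  have iff: "hitting_time X A \<omega> < \<infinity> \<and> path_until_hit X A \<omega> = w \<longleftrightarrow>
      w \<in> hitting_paths V A \<and> (\<forall>i<length w. X i \<omega> = w ! i)" if "\<omega> \<in> space (PP x)" for \<omega> w
    using X_in_V[OF x that] by (rule path_until_hit_eq_iff)
  have "{\<omega> \<in> space (PP x). hitting_time X A \<omega> < \<infinity> \<and> path_until_hit X A \<omega> \<in> R} = (\<Union>w\<in>?I. ?E w)"
  proof (intro set_eqI iffI)
    fix \<omega> assume "\<omega> \<in> {\<omega> \<in> space (PP x). hitting_time X A \<omega> < \<infinity> \<and> path_until_hit X A \<omega> \<in> R}"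
    then show "\<omega> \<in> (\<Union>w\<in>?I. ?E w)"
      using iff[of \<omega> "path_until_hit X A \<omega>"] by auto
  next
    fix \<omega> assume "\<omega> \<in> (\<Union>w\<in>?I. ?E w)"
    then obtain w where "w \<in> ?I" "\<omega> \<in> ?E w"
      by blast
    then show "\<omega> \<in> {\<omega> \<in> space (PP x). hitting_time X A \<omega> < \<infinity> \<and> path_until_hit X A \<omega> \<in> R}"
      using iff[of \<omega> w] by simp
  qed
  also have "emeasure (PP x) \<dots> = (\<integral>\<^sup>+w. emeasure (PP x) (?E w) \<partial>count_space ?I)"
  proof (rule emeasure_UN_countable)
    have "?I \<subseteq> lists V"
      by (auto simp: hitting_paths_def)
    then show "countable ?I"
      using countable_lists[OF countable_finite[OF finite_states]] countable_subset by blast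
    show "disjoint_family_on ?E ?I"
      unfolding disjoint_family_on_def
    proof (intro ballI impI)
      fix w w' assume w: "w \<in> ?I" "w' \<in> ?I" "w \<noteq> w'"
      show "?E w \<inter> ?E w' = {}"
      proof (rule equals0I)
        fix \<omega> assume "\<omega> \<in> ?E w \<inter> ?E w'"
        then have "path_until_hit X A \<omega> = w" "path_until_hit X A \<omega> = w'"
          using iff[of \<omega> w] iff[of \<omega> w'] w(1,2) by simp_all
        then show False using w(3) by simp
      qed
    qed
    show "?E w \<in> sets (PP x)" if "w \<in> ?I" for w
      by (rule sets_X_path[OF x])
  qed
  also have "\<dots> = (\<integral>\<^sup>+w. (if hd w = x then weight (killed_kernel A) w else 0) \<partial>count_space ?I)"
    by (rule nn_integral_cong, rule emeasure_X_path[OF x]) simp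
  also have "\<dots> = (\<integral>\<^sup>+w. weight (killed_kernel A) w \<partial>count_space {w \<in> R. w \<noteq> [] \<and> hd w = x \<and> last w \<in> A})"
  proof -
    have "(if hd w = x then weight (killed_kernel A) w else 0) * indicator ?I w =
        weight (killed_kernel A) w * indicator {w \<in> R. w \<noteq> [] \<and> hd w = x \<and> last w \<in> A} w" for w
      using weight_killed_eq_0[of w A] x
      by (cases "w \<in> hitting_paths V A") (auto simp: hitting_paths_def split: split_indicator)
    then show ?thesis
      by (subst (1 2) nn_integral_count_space_indicator) simp_all
  qed
  finally show ?thesis .
qed

end

theorem theorem1p1:
  fixes V :: "'a set"
    and P :: "'a \<Rightarrow> 'a \<Rightarrow> real"
    and \<Omega> :: "'w measure"
    and X :: "nat \<Rightarrow> 'w \<Rightarrow> 'a"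
    and PP :: "'a \<Rightarrow> 'w measure"
    and W :: "nat \<Rightarrow> 'a set"
    and m :: nat
    and A :: "'a set"
    and x :: 'a
    and B :: "'a list set"
  assumes "markov_chain V P \<Omega> X PP"
    and "m \<ge> 1"
    and "W 1 \<noteq> {}"
    and "\<And>i. 1 \<le> i \<Longrightarrow> i < m \<Longrightarrow> W i \<subseteq> W (Suc i)"
    and "W m = V"
    and "A \<subseteq> V"
    and "x \<in> V"
    and "\<P>(\<omega> in PP x. hitting_time X A \<omega> < \<infinity>) = 1"
  shows "\<P>(\<omega> in PP x. hitting_time X A \<omega> < \<infinity> \<and> loop_erasure V (path_until_hit X A \<omega>) \<in> B) =
         \<P>(\<omega> in PP x. hitting_time X A \<omega> < \<infinity> \<and> iterated_ple W m (path_until_hit X A \<omega>) \<in> B)"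
proof -
  interpret markov_chain V P \<Omega> X PP by fact
  \<comment> \<open>\<open>W 0\<close> is arbitrary in the statement; resetting it to the empty set
    gives the convention of \<open>weight_iterated_erase\<close>.\<close>
  define W0 where "W0 i = (if i = 0 then {} else W i)" for i
  have W0: "W0 m = V" "W0 0 = {}" "\<And>i. i < m \<Longrightarrow> W0 i \<subseteq> W0 (Suc i)"
    using assms by (auto simp: W0_def)
  let ?k = "killed_kernel A"
  let ?S = "{w \<in> B. w \<noteq> [] \<and> hd w = x \<and> last w \<in> A}"
  let ?em = "\<lambda>f. emeasure (PP x) {\<omega> \<in> space (PP x). hitting_time X A \<omega> < \<infinity> \<and> f (path_until_hit X A \<omega>) \<in> B}"
  have ne: "path_until_hit X A \<omega> \<noteq> []" for \<omega>
    by (simp add: path_until_hit_def)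
  have iter: "iterated_erase W0 n w = [] \<longleftrightarrow> w = []" "hd (iterated_erase W0 n w) = hd w"
      "last (iterated_erase W0 n w) = last w" for n w
    by (induction n) (simp_all add: hd_erase last_erase)
  have em: "?em f = (\<integral>\<^sup>+w. weight ?k w \<partial>count_space {w. f w \<in> ?S})"
    if "\<And>w. f w = [] \<longleftrightarrow> w = []" "\<And>w. hd (f w) = hd w" "\<And>w. last (f w) = last w" for f
  proof -
    \<comment> \<open>As \<open>f\<close> keeps the endpoints, the conditions on \<open>w\<close>
      become conditions on \<open>f w\<close>, so the index set is a full preimage of
      \<open>?S\<close>.\<close>
    have "{w \<in> {w. f w \<in> B}. w \<noteq> [] \<and> hd w = x \<and> last w \<in> A} = {w. f w \<in> ?S}"
      using that by auto
    then show ?thesis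
      using emeasure_path_until_hit[OF \<open>x \<in> V\<close>, of A "{w. f w \<in> B}"] by simp
  qed
  have "?em (loop_erasure V) = ?em (erase V)"
    using ne by (simp add: loop_erasure_def partial_loop_erasure_eq_erase)
  also have "\<dots> = (\<integral>\<^sup>+w. weight ?k w \<partial>count_space {w. erase V w \<in> ?S})"
    by (intro em) (simp_all add: hd_erase last_erase)
  also have "\<dots> = (\<integral>\<^sup>+w. weight ?k w \<partial>count_space {w. iterated_erase W0 m w \<in> ?S})"
    using weight_iterated_erase[where m = m and W = W0 and k = ?k and R = ?S] W0 finite_states by simp
  also have "\<dots> = ?em (iterated_erase W0 m)"
    by (intro em[symmetric]) (simp_all add: iter)
  also have "\<dots> = ?em (iterated_ple W m)"
    using partial_loop_erasure_iterated[of _ W0 W m] ne W0(2) by (simp add: W0_def)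
  finally show ?thesis
    by (simp add: measure_def)
qed

end
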